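(* Let $S$ be a numerical semigroup with multiplicity $m$ and Kunz coordinates $(x_1,\ldots,x_{m-1})$, and set $x_0=0$. Then $S$ has the Arf property if and only if for any $i,j\in\{0,\ldots,m-1\}$ the following two conditions hold: (i) if $x_i+\lceil (i-j)/m\rceil\ge x_j$, then $$x_i-x_{\overline{2j-i}}+2\left\lceil\frac{i-j}{m}\right\rceil+\left\lfloor\frac{2j}{m}\right\rfloor-\left\lfloor\frac{\overline{2j-i}+i}{m}\right\rfloor\ge 0;$$ (ii) if $x_i+\lceil (i-j)/m\rceil< x_j$, then $$x_j-x_{\overline{2j-i}}+\left\lceil\frac{i-j}{m}\right\rceil+\left\lfloor\frac{2j}{m}\right\rfloor-\left\lfloor\frac{\overline{2j-i}+i}{m}\right\rfloor\ge 0.$$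
   Context: A numerical semigroup is a submonoid $S$ of $(\mathbb N,+)$ ($\mathbb N$ the nonnegative integers) with finite complement in $\mathbb N$. Its multiplicity $m$ is the least positive integer in $S$. $S$ has the Arf property if $x+y-z\in S$ for all $x,y,z\in S$ with $x\ge y\ge z$ (equivalently $2x-y\in S$ for all $x\ge y$ in $S$). For $i\in\{0,\ldots,m-1\}$ let $w(i)=\min\{n\in S\mid n\equiv i \pmod m\}$ (so $w(0)=0$). The Kunz coordinates $(x_1,\ldots,x_{m-1})$ of $S$ are the positive integers defined by $w(k)=x_km+k$ for $k\in\{1,\ldots,m-1\}$; by convention $x_0=0$. For an integer $z$, $\overline z\in\{0,\ldots,m-1\}$ denotes the remainder of the division of $z$ by $m$. *)

theory Defs
  imports Complex_Main "HOL-Number_Theory.Cong"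
begin

definition numerical_semigroup :: "nat set \<Rightarrow> bool" where
  "numerical_semigroup S \<longleftrightarrow>
     0 \<in> S \<and> (\<forall>x\<in>S. \<forall>y\<in>S. x + y \<in> S) \<and> finite (UNIV - S)"

definition multiplicity_of :: "nat set \<Rightarrow> nat" where
  "multiplicity_of S = (LEAST n. 0 < n \<and> n \<in> S)"

text \<open>The subtraction on \<open>nat\<close> does not truncate here, since \<open>z \<le> y \<le> x\<close>.\<close>

definition Arf :: "nat set \<Rightarrow> bool" where
  "Arf S \<longleftrightarrow> (\<forall>x\<in>S. \<forall>y\<in>S. \<forall>z\<in>S. y \<le> x \<and> z \<le> y \<longrightarrow> x + y - z \<in> S)"

definition least_congruent :: "nat set \<Rightarrow> nat \<Rightarrow> nat" where
  "least_congruent S i = (LEAST n. n \<in> S \<and> [n = i] (mod multiplicity_of S))"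

text \<open>Only the values of \<open>x\<close> on \<open>{0..<multiplicity_of S}\<close> are constrained;
  \<open>x 0 = 0\<close> is the usual convention extending the coordinates.\<close>

definition kunz_coordinates :: "nat set \<Rightarrow> (nat \<Rightarrow> nat) \<Rightarrow> bool" where
  "kunz_coordinates S x \<longleftrightarrow>
     x 0 = 0 \<and>
     (\<forall>k\<in>{1..<multiplicity_of S}.
        0 < x k \<and> least_congruent S k = x k * multiplicity_of S + k)"

definition remainder :: "nat \<Rightarrow> int \<Rightarrow> nat" where
  "remainder m z = nat (z mod int m)"

lemma multiplicity_of_props:
  assumes "numerical_semigroup S"
  shows "0 < multiplicity_of S" "multiplicity_of S \<in> S"
    and "\<And>n. 0 < n \<Longrightarrow> n \<in> S \<Longrightarrow> multiplicity_of S \<le> n"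
proof -
  have "finite (UNIV - S)" using assms by (simp add: numerical_semigroup_def)
  then have "\<exists>b. \<forall>n\<in>UNIV - S. n \<le> b"
    by (simp only: finite_nat_set_iff_bounded_le)
  then obtain b where b: "\<forall>n\<in>UNIV - S. n \<le> b" ..
  have "Suc b \<in> S" using b by force
  then have "0 < Suc b \<and> Suc b \<in> S" by simp
  from LeastI[of "\<lambda>n. 0 < n \<and> n \<in> S", OF this]
  show "0 < multiplicity_of S" "multiplicity_of S \<in> S"
    by (simp_all add: multiplicity_of_def)
  show "multiplicity_of S \<le> n" if "0 < n" "n \<in> S" for n
    unfolding multiplicity_of_def using that by (intro Least_le) simp
qed

lemma least_congruent_props:
  assumes "numerical_semigroup S"
  shows "least_congruent S i \<in> S" "[least_congruent S i = i] (mod multiplicity_of S)"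
proof -
  let ?m = "multiplicity_of S"
  have "finite (UNIV - S)" using assms by (simp add: numerical_semigroup_def)
  then have "\<exists>b. \<forall>n\<in>UNIV - S. n \<le> b"
    by (simp only: finite_nat_set_iff_bounded_le)
  then obtain b where b: "\<forall>n\<in>UNIV - S. n \<le> b" ..
  define n where "n = i + Suc b * ?m"
  have "Suc b * 1 \<le> Suc b * ?m"
    using multiplicity_of_props(1)[OF assms] by (intro mult_le_mono2) simp
  then have "Suc b \<le> n" unfolding n_def by (metis mult.right_neutral trans_le_add2)
  then have "n \<in> S" using b by force
  moreover have "[n = i] (mod ?m)" unfolding n_def cong_def by (rule mod_mult_self1)
  ultimately have "n \<in> S \<and> [n = i] (mod ?m)" ..
  from LeastI[of "\<lambda>n. n \<in> S \<and> [n = i] (mod ?m)", OF this]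
  show "least_congruent S i \<in> S" "[least_congruent S i = i] (mod ?m)"
    by (simp_all add: least_congruent_def)
qed

lemma kunz_coordinates_exist:
  assumes "numerical_semigroup S"
  shows "\<exists>x. kunz_coordinates S x"
proof -
  let ?m = "multiplicity_of S"
  define x :: "nat \<Rightarrow> nat" where "x k = (if k = 0 then 0 else least_congruent S k div ?m)" for k
  have "0 < x k \<and> least_congruent S k = x k * ?m + k" if k: "1 \<le> k" "k < ?m" for k
  proof -
    note w = least_congruent_props[OF assms, of k]
    have md: "least_congruent S k mod ?m = k" using w(2) k by (simp add: cong_def)
    have "least_congruent S k \<noteq> 0"
    proof
      assume "least_congruent S k = 0"
      with md k show False by simp
    qed
    then have "0 < least_congruent S k" by simp
    then have "?m \<le> least_congruent S k" using multiplicity_of_props(3)[OF assms] w(1) by blast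
    then have "0 < least_congruent S k div ?m"
      using multiplicity_of_props(1)[OF assms] by (simp add: div_greater_zero_iff)
    moreover have "least_congruent S k = least_congruent S k div ?m * ?m + k"
      using md div_mult_mod_eq[of "least_congruent S k" ?m] by simp
    ultimately show ?thesis using k by (simp add: x_def)
  qed
  moreover have "x 0 = 0" by (simp add: x_def)
  ultimately have "kunz_coordinates S x" unfolding kunz_coordinates_def by force
  then show ?thesis by blast
qed

lemma kunz_coordinates_unique:
  assumes "kunz_coordinates S x" "kunz_coordinates S y" "k < multiplicity_of S"
  shows "x k = y k"
proof (cases "k = 0")
  case False
  then have k: "k \<in> {1..<multiplicity_of S}" using assms(3) by simp
  have "x k * multiplicity_of S + k = y k * multiplicity_of S + k"
    using assms(1,2) k unfolding kunz_coordinates_def by metis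
  then show ?thesis using assms(3) by simp
qed (use assms in \<open>simp add: kunz_coordinates_def\<close>)

end

theory Submission
  imports Defs
begin

text \<open>Write the elements of \<open>S\<close> congruent to \<open>j\<close> and \<open>i\<close> as \<open>a m + j\<close> with \<open>a \<ge> x\<^sub>j\<close> and
  \<open>b m + i\<close> with \<open>b \<ge> x\<^sub>i\<close>. With \<open>c = \<lceil>(i - j)/m\<rceil>\<close>, the first dominates the second iff
  \<open>a \<ge> b + c\<close>, and then twice the first minus the second lies in \<open>S\<close> iff \<open>2a - b\<close> reaches a
  bound depending on \<open>i\<close> and \<open>j\<close> only. So the Arf property bounds the minimum of \<open>2a - b\<close> on
  that region. This minimum is at \<open>(a, b) = (x\<^sub>i + c, x\<^sub>i)\<close> if \<open>x\<^sub>i + c \<ge> x\<^sub>j\<close> and at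
  \<open>(x\<^sub>j, x\<^sub>j - c)\<close> otherwise, giving the two conditions.\<close>

text \<open>Doubling a term and subtracting its predecessor gives its successor, so the induction
  carries two consecutive terms.\<close>

lemma arithmetic_progression_mem:
  fixes S :: "nat set"
  assumes double: "\<And>s t. s \<in> S \<Longrightarrow> t \<in> S \<Longrightarrow> t \<le> s \<Longrightarrow> 2 * s - t \<in> S"
    and "z \<in> S" "z + d \<in> S"
  shows "z + k * d \<in> S"
proof -
  have "z + k * d \<in> S \<and> z + Suc k * d \<in> S"
  proof (induction k)
    case (Suc k)
    have "2 * (z + Suc k * d) - (z + k * d) = z + Suc (Suc k) * d" by simp
    moreover have "2 * (z + Suc k * d) - (z + k * d) \<in> S" using Suc by (intro double) simp_all
    ultimately show ?case using Suc by argo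
  qed (use assms in simp)
  then show ?thesis ..
qed

text \<open>Taking \<open>x = y\<close> gives one direction. The converse is a Euclidean descent on
  the gap \<open>y - z\<close>, using that the whole progression from \<open>z\<close> with
  difference \<open>y - z\<close> stays in \<open>S\<close>.\<close>

lemma Arf_iff_double: "Arf S \<longleftrightarrow> (\<forall>s\<in>S. \<forall>t\<in>S. t \<le> s \<longrightarrow> 2 * s - t \<in> S)"
proof
  assume "Arf S"
  then show "\<forall>s\<in>S. \<forall>t\<in>S. t \<le> s \<longrightarrow> 2 * s - t \<in> S"
    unfolding Arf_def by (metis le_refl mult_2)
next
  assume "\<forall>s\<in>S. \<forall>t\<in>S. t \<le> s \<longrightarrow> 2 * s - t \<in> S"
  then have double: "2 * s - t \<in> S" if "s \<in> S" "t \<in> S" "t \<le> s" for s t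
    using that by blast
  have "w + y - z \<in> S" if "w \<in> S" "y \<in> S" "z \<in> S" "y \<le> w" "z \<le> y" for w y z
    using that
  proof (induction "y - z" arbitrary: w y z rule: less_induct)
    case less
    show ?case
    proof (cases "y = z")
      case False
      define d where "d = y - z"
      define k where "k = (w - z) div d"
      \<comment> \<open>The last term of the progression that does not exceed \<open>w\<close>; the
        new gap \<open>w - u\<close> is a remainder modulo \<open>d\<close>.\<close>
      define u where "u = z + k * d"
      have d: "0 < d" "y = z + d" using False less.prems by (auto simp: d_def)
      have w: "w = u + (w - z) mod d"
        using less.prems unfolding u_def k_def by (simp add: div_mult_mod_eq)
      have e: "(w - z) mod d < d" using d by simp
      have AP: "z + n * d \<in> S" for n
        using arithmetic_progression_mem[of S z d n] double less.prems d by blast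
      have "u \<in> S" "u + d \<in> S" using AP[of k] AP[of "Suc k"] by (simp_all add: u_def ac_simps)
      \<comment> \<open>The triple \<open>(u + d, w, u)\<close> has the same value as \<open>(w, y, z)\<close> but a smaller gap.\<close>
      moreover have "w - u < y - z" "w \<le> u + d" "u \<le> w" using w e d by linarith+
      ultimately have "(u + d) + w - u \<in> S" using less.hyps[of w u "u + d"] less.prems by blast
      moreover have "(u + d) + w - u = w + y - z" using d by simp
      ultimately show ?thesis by simp
    qed (use less.prems in simp)
  qed
  then show "Arf S" unfolding Arf_def by blast
qed

lemma numerical_semigroup_add_mult:
  assumes "numerical_semigroup S" "s \<in> S" "t \<in> S"
  shows "s + k * t \<in> S"
proof (induction k)
  case (Suc k)
  then have "(s + k * t) + t \<in> S" using assms unfolding numerical_semigroup_def by blast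
  then show ?case by (simp add: ac_simps)
qed (use assms in simp)

lemma kunz_coordinates_least:
  assumes "numerical_semigroup S" "kunz_coordinates S x" "k < multiplicity_of S"
  shows "least_congruent S k = x k * multiplicity_of S + k"
proof (cases "k = 0")
  \<comment> \<open>\<open>kunz_coordinates\<close> prescribes the least element only for positive
    \<open>k\<close>; for the class of 0 it is 0 itself, matching \<open>x 0 = 0\<close>.\<close>
  case True
  have "0 \<in> S" using assms(1) by (simp add: numerical_semigroup_def)
  then have "least_congruent S 0 \<le> 0"
    unfolding least_congruent_def by (intro Least_le) simp
  then show ?thesis using True assms(2) by (simp add: kunz_coordinates_def)
next
  case False
  then show ?thesis using assms(2,3) by (simp add: kunz_coordinates_def)
qed

text \<open>As the multiplicity lies in \<open>S\<close>, adding it repeatedly to the least element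
  of a class never leaves \<open>S\<close>.\<close>

lemma kunz_coordinates_mem_iff:
  assumes S: "numerical_semigroup S" and x: "kunz_coordinates S x"
    and k: "k < multiplicity_of S"
  shows "a * multiplicity_of S + k \<in> S \<longleftrightarrow> x k \<le> a"
proof
  let ?m = "multiplicity_of S"
  note w = kunz_coordinates_least[OF S x k]
  show "x k \<le> a" if "a * ?m + k \<in> S"
  proof -
    have "least_congruent S k \<le> a * ?m + k"
      unfolding least_congruent_def using that by (intro Least_le) (simp add: cong_def)
    then show ?thesis using w k by simp
  qed
  show "a * ?m + k \<in> S" if "x k \<le> a"
  proof -
    have "x k * ?m + k + (a - x k) * ?m \<in> S"
      using numerical_semigroup_add_mult[OF S least_congruent_props(1)[OF S, of k]
          multiplicity_of_props(2)[OF S]] w by simp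
    moreover have "x k * ?m + k + (a - x k) * ?m = a * ?m + k"
      using that by (simp add: diff_mult_distrib)
    ultimately show ?thesis by simp
  qed
qed

text \<open>Division by \<open>m\<close> bounds the integer \<open>a - b\<close> below by a real
  number, which may then be rounded up.\<close>

lemma mult_add_le_iff_ceiling:
  fixes m i j a b :: nat
  assumes "0 < m"
  shows "b * m + i \<le> a * m + j \<longleftrightarrow> int b + \<lceil>(real i - real j) / real m\<rceil> \<le> int a"
proof -
  have "b * m + i \<le> a * m + j \<longleftrightarrow> real (b * m + i) \<le> real (a * m + j)"
    by (rule of_nat_le_iff[symmetric])
  also have "\<dots> \<longleftrightarrow> (real i - real j) / real m \<le> of_int (int a - int b)"
    using assms by (simp add: field_simps)
  also have "\<dots> \<longleftrightarrow> \<lceil>(real i - real j) / real m\<rceil> \<le> int a - int b"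
    by (rule ceiling_le_iff[symmetric])
  finally show ?thesis by linarith
qed

text \<open>Since \<open>r + i\<close> and \<open>2 * j\<close> leave the same remainder modulo
  \<open>m\<close>, their difference is \<open>m\<close> times the difference of their quotients,
  which are the two floors.\<close>

lemma remainder_floor:
  fixes m i j :: nat
  assumes "0 < m"
  defines "r \<equiv> remainder m (2 * int j - int i)"
  shows "2 * int j - int i =
    (\<lfloor>2 * real j / real m\<rfloor> - \<lfloor>(real r + real i) / real m\<rfloor>) * int m + int r"
proof -
  have r: "int r = (2 * int j - int i) mod int m"
    using assms by (simp add: remainder_def)
  have "(int r + int i) mod int m = (2 * int j) mod int m"
    unfolding r by (simp add: mod_add_left_eq)
  then have "int r + int i - (int r + int i) div int m * int m =
      2 * int j - (2 * int j) div int m * int m"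
    by (simp add: minus_div_mult_eq_mod)
  moreover have "\<lfloor>2 * real j / real m\<rfloor> = (2 * int j) div int m"
    using floor_divide_of_nat_eq[of "2 * j" m, where 'a = real] by (simp add: zdiv_int)
  moreover have "\<lfloor>(real r + real i) / real m\<rfloor> = (int r + int i) div int m"
    using floor_divide_of_nat_eq[of "r + i" m, where 'a = real] by (simp add: zdiv_int)
  ultimately show ?thesis by (simp add: algebra_simps)
qed

lemma double_mem_iff:
  fixes m i j a b :: nat
  assumes S: "numerical_semigroup S" and m: "m = multiplicity_of S"
    and x: "kunz_coordinates S x" and le: "b * m + i \<le> a * m + j"
  defines "r \<equiv> remainder m (2 * int j - int i)"
  shows "2 * (a * m + j) - (b * m + i) \<in> S \<longleftrightarrow>
    int (x r) - \<lfloor>2 * real j / real m\<rfloor> + \<lfloor>(real r + real i) / real m\<rfloor> \<le> 2 * int a - int b"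
proof -
  define q where "q = \<lfloor>2 * real j / real m\<rfloor> - \<lfloor>(real r + real i) / real m\<rfloor>"
  define n where "n = 2 * (a * m + j) - (b * m + i)"
  have m0: "0 < m" using multiplicity_of_props(1)[OF S] m by simp
  have rm: "r < m" using m0 by (simp add: r_def remainder_def nat_less_iff)
  have "2 * int j - int i = q * int m + int r"
    using remainder_floor[OF m0] unfolding q_def r_def .
  moreover have "int n = 2 * (int a * int m + int j) - (int b * int m + int i)"
    using le by (simp add: n_def of_nat_diff)
  ultimately have n: "int n = (2 * int a - int b + q) * int m + int r"
    by (simp add: algebra_simps)
  \<comment> \<open>Because \<open>r < m\<close>, the expression for \<open>n\<close> is its
    division by \<open>m\<close> with remainder, so membership in \<open>S\<close> compares the
    quotient with \<open>x r\<close>.\<close>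
  have "int n mod int m = int r" "int n div int m = 2 * int a - int b + q"
    using rm by (simp_all add: n)
  then have nm: "n mod m = r" and nd: "int (n div m) = 2 * int a - int b + q"
    by (simp_all add: zdiv_int flip: zmod_int)
  have "n = n div m * m + r" using nm div_mult_mod_eq[of n m] by simp
  then have "n \<in> S \<longleftrightarrow> x r \<le> n div m"
    using kunz_coordinates_mem_iff[OF S x, of r "n div m"] rm m by simp
  then show ?thesis using nd unfolding n_def[symmetric] q_def by linarith
qed

text \<open>On the region \<open>2a - b = a + (a - b)\<close> is at least \<open>a + c\<close>, and
  \<open>a\<close> is at least both \<open>q\<close> and \<open>p + c\<close>. Equality holds at the
  larger of these with \<open>b = a - c\<close>.\<close>

lemma minimum_double_minus_iff:
  fixes c l :: int and p q :: nat
  shows "(\<forall>a b :: nat. q \<le> a \<and> p \<le> b \<and> int b + c \<le> int a \<longrightarrow> l \<le> 2 * int a - int b) \<longleftrightarrow>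
    (int q \<le> int p + c \<longrightarrow> l \<le> int p + 2 * c) \<and> (int p + c < int q \<longrightarrow> l \<le> int q + c)"
    (is "?L \<longleftrightarrow> ?R")
proof
  assume L: ?L
  show ?R
  proof (intro conjI impI)
    assume "int q \<le> int p + c"
    \<comment> \<open>The witnesses do not truncate: here \<open>p + c\<close> is at least
      \<open>q\<close>, and in the other case \<open>q - c\<close> exceeds \<open>p\<close>.\<close>
    then show "l \<le> int p + 2 * c" using L[rule_format, of "nat (int p + c)" p] by simp
  next
    assume "int p + c < int q"
    then show "l \<le> int q + c" using L[rule_format, of q "nat (int q - c)"] by simp
  qed
next
  assume ?R
  then show ?L by (cases "int q \<le> int p + c") auto
qed

theorem proposition9:
  fixes S :: "nat set" and m :: nat and x :: "nat \<Rightarrow> nat"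
  assumes "numerical_semigroup S"
    and "m = multiplicity_of S"
    and "kunz_coordinates S x"
  shows "Arf S \<longleftrightarrow>
    (\<forall>i\<in>{0..<m}. \<forall>j\<in>{0..<m}.
      (int (x i) + \<lceil>(real i - real j) / real m\<rceil> \<ge> int (x j) \<longrightarrow>
         int (x i) - int (x (remainder m (2 * int j - int i)))
           + 2 * \<lceil>(real i - real j) / real m\<rceil> + \<lfloor>2 * real j / real m\<rfloor>
           - \<lfloor>(real (remainder m (2 * int j - int i)) + real i) / real m\<rfloor> \<ge> 0) \<and>
      (int (x i) + \<lceil>(real i - real j) / real m\<rceil> < int (x j) \<longrightarrow>
         int (x j) - int (x (remainder m (2 * int j - int i)))
           + \<lceil>(real i - real j) / real m\<rceil> + \<lfloor>2 * real j / real m\<rfloor>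
           - \<lfloor>(real (remainder m (2 * int j - int i)) + real i) / real m\<rfloor> \<ge> 0))"
proof -
  note S = assms(1) and m = assms(2) and x = assms(3)
  define c where "c i j = \<lceil>(real i - real j) / real m\<rceil>" for i j :: nat
  define r where "r i j = remainder m (2 * int j - int i)" for i j :: nat
  define l where "l i j =
    int (x (r i j)) - \<lfloor>2 * real j / real m\<rfloor> + \<lfloor>(real (r i j) + real i) / real m\<rfloor>" for i j
  have m0: "0 < m" using multiplicity_of_props(1)[OF S] m by simp
  have mem: "a * m + k \<in> S \<longleftrightarrow> x k \<le> a" if "k < m" for a k
    using kunz_coordinates_mem_iff[OF S x] that m by simp
  have "Arf S \<longleftrightarrow> (\<forall>i<m. \<forall>j<m. \<forall>a b. a * m + j \<in> S \<and> b * m + i \<in> S \<and>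
      b * m + i \<le> a * m + j \<longrightarrow> 2 * (a * m + j) - (b * m + i) \<in> S)"
    (is "_ \<longleftrightarrow> ?classes")
  proof
    assume "Arf S"
    then show ?classes unfolding Arf_iff_double by blast
  next
    assume R: ?classes
    have "2 * s - t \<in> S" if "s \<in> S" "t \<in> S" "t \<le> s" for s t
      using R[rule_format, of "t mod m" "s mod m" "s div m" "t div m"] that m0 by simp
    then show "Arf S" unfolding Arf_iff_double by blast
  qed
  \<comment> \<open>\<open>double_mem_iff\<close> is valid only under the order premise, so the
    conclusion is rewritten with that premise in hand.\<close>
  also have "\<dots> \<longleftrightarrow> (\<forall>i<m. \<forall>j<m. \<forall>a b. x j \<le> a \<and> x i \<le> b \<and> int b + c i j \<le> int a \<longrightarrow>
      l i j \<le> 2 * int a - int b)"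
    using mem mult_add_le_iff_ceiling[OF m0] double_mem_iff[OF S m x]
    unfolding c_def l_def r_def by (simp cong: conj_cong imp_cong)
  also have "\<dots> \<longleftrightarrow> (\<forall>i<m. \<forall>j<m.
      (int (x j) \<le> int (x i) + c i j \<longrightarrow> l i j \<le> int (x i) + 2 * c i j) \<and>
      (int (x i) + c i j < int (x j) \<longrightarrow> l i j \<le> int (x j) + c i j))"
    by (simp add: minimum_double_minus_iff)
  also have "\<dots> \<longleftrightarrow> (\<forall>i\<in>{0..<m}. \<forall>j\<in>{0..<m}.
      (int (x i) + c i j \<ge> int (x j) \<longrightarrow>
         int (x i) - int (x (r i j)) + 2 * c i j + \<lfloor>2 * real j / real m\<rfloor>
           - \<lfloor>(real (r i j) + real i) / real m\<rfloor> \<ge> 0) \<and>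
      (int (x i) + c i j < int (x j) \<longrightarrow>
         int (x j) - int (x (r i j)) + c i j + \<lfloor>2 * real j / real m\<rfloor>
           - \<lfloor>(real (r i j) + real i) / real m\<rfloor> \<ge> 0))"
    unfolding l_def by (intro iffI ballI allI impI; force)
  finally show ?thesis unfolding c_def r_def .
qed

end
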